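(* Let $a_1\ge a_2\ge\dots\ge a_n>0$ and let $M$ be the Orlicz function with $$ {M^{*}}^{-1}\Big(\frac{l}{n}\Big)=\left\{\Big(\frac1n\sum_{i=1}^{l}a_i\Big)^2+\frac{l}{n}\Big(\frac1n\sum_{i=l+1}^{n}|a_i|^2\Big)\right\}^{1/2} $$ for all $l=1,2,\dots,n$ and such that ${M^{*}}^{-1}$ is an affine function between the given values. Then for all $x=(x_1,\dots,x_n)\in\mathbb{R}^n$ $$ \frac{1}{2\sqrt5}\,\frac{(n-1)^2}{n^2+(n-1)^2}\,\|x\|_M\;\le\;\underset{\pi}{\mathrm{Ave}}\Big(\sum_{i=1}^n|x_i a_{\pi(i)}|^2\Big)^{1/2}\;\le\;\frac{2\sqrt2}{c_n}\,\|x\|_M , $$ where $c_n=1-\frac1{2!}+\frac1{3!}-\dots+(-1)^{n+1}\frac1{n!}$.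
   Context: Here $n\in\mathbb{N}$. An Orlicz function is a convex function $M:\mathbb{R}\to\mathbb{R}$ with $M(t)=M(-t)$, $M(0)=0$, and $M(t)>0$ if $t\neq0$. If $M'$ is invertible on $(0,\infty)$, then the dual function $M^*$ of $M$ is given by $M^*(t)=\int_0^t {M'}^{-1}(s)\,ds$. ${M^*}^{-1}$ denotes the inverse function of $M^*$ on $[0,\infty)$. The Orlicz norm of a sequence $x=\{x_i\}_{i=1}^\infty$ is $$\|x\|_M=\sup\Big\{\sum_{i=1}^\infty x_iy_i\;\Big|\;\sum_{i=1}^\infty M^*(y_i)\le1\Big\},$$ and a vector $x\in\mathbb{R}^n$ is regarded as a sequence by adding zeros. $\underset{\pi}{\mathrm{Ave}}$ denotes the average over all permutations $\pi$ of $\{1,2,\dots,n\}$. *)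

theory Defs
  imports "HOL-Analysis.Analysis" "HOL-Combinatorics.Permutations"
begin

(* Unlike the usual strict definition, M is allowed to vanish on a neighbourhood of 0
   (nonnegativity follows from convexity and symmetry).  This is needed to speak about M with a
   piecewise affine dual function: if the dual has slope c > 0 at 0, then M = 0 on [-c, c]. *)
definition orlicz_function :: "(real \<Rightarrow> real) \<Rightarrow> bool" where
  "orlicz_function M \<longleftrightarrow> convex_on UNIV M \<and> (\<forall>t. M (- t) = M t) \<and> M 0 = 0"

(* Generalized inverse of the derivative M' on (0, oo).  A convex M is differentiable off a
   countable set; M' is nondecreasing where it exists, but may have jumps and be locally
   constant.  The supremum is 0 for the empty set and infinite for an unbounded set. *)
definition deriv_inv :: "(real \<Rightarrow> real) \<Rightarrow> real \<Rightarrow> ennreal" where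
  "deriv_inv M s = (SUP u \<in> {u. 0 < u \<and> (\<exists>D\<le>s. (M has_real_derivative D) (at u))}. ennreal u)"

(* M^*(t) is the integral of the (generalized) inverse of M' from 0 to t, extended to an even
   function; see orlicz_dual_eq_integral_inv for the case of an invertible M'. *)
definition orlicz_dual :: "(real \<Rightarrow> real) \<Rightarrow> real \<Rightarrow> ennreal" where
  "orlicz_dual M t = (\<integral>\<^sup>+ s \<in> {0..\<bar>t\<bar>}. deriv_inv M s \<partial>lborel)"

(* The inverse function of M^* on [0, oo); meaningful only if M^* is injective there and
   attains the value s. *)
definition orlicz_dual_inv :: "(real \<Rightarrow> real) \<Rightarrow> real \<Rightarrow> real" where
  "orlicz_dual_inv M s = inv_into {0..} (orlicz_dual M) (ennreal s)"

definition orlicz_norm :: "(real \<Rightarrow> real) \<Rightarrow> (nat \<Rightarrow> real) \<Rightarrow> ereal" where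
  "orlicz_norm M x =
     (SUP y \<in> {y. summable (\<lambda>i. x i * y i) \<and> (\<Sum>i. orlicz_dual M (y i)) \<le> 1}.
        ereal (\<Sum>i. x i * y i))"

definition zero_extend :: "nat \<Rightarrow> (nat \<Rightarrow> real) \<Rightarrow> nat \<Rightarrow> real" where
  "zero_extend n x = (\<lambda>i. if i < n then x i else 0)"

lemma orlicz_dual_eq_integral_inv:
  fixes M m :: "real \<Rightarrow> real"
  assumes conv: "convex_on UNIV M"
    and der: "\<And>u. 0 < u \<Longrightarrow> (M has_real_derivative m u) (at u)"
    and bij: "bij_betw m {0<..} {0<..}"
  shows "orlicz_dual M t = (\<integral>\<^sup>+ s \<in> {0..\<bar>t\<bar>}. ennreal (inv_into {0<..} m s) \<partial>lborel)"
proof -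
  have mono: "m x \<le> m y" if "0 < x" "x < y" for x y
  proof -
    have "M y - M x \<ge> m x * (y - x)"
      using convex_on_imp_above_tangent[OF conv, of x y "m x"] der[of x] that by auto
    moreover have "M x - M y \<ge> m y * (x - y)"
      using convex_on_imp_above_tangent[OF conv, of y x "m y"] der[of y] that by auto
    ultimately have "0 \<ge> (m x - m y) * (y - x)"
      by (simp add: algebra_simps)
    then show ?thesis
      using that by (simp add: mult_le_0_iff)
  qed
  have smono: "m x < m y" if "0 < x" "x < y" for x y
  proof -
    have "m x \<noteq> m y"
      using inj_onD[OF bij_betw_imp_inj_on[OF bij], of x y] that by auto
    then show ?thesis
      using mono[OF that] by simp
  qed
  have eq: "deriv_inv M s = ennreal (inv_into {0<..} m s)" if "0 < s" for s
  proof -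
    let ?u = "inv_into {0<..} m s"
    have img: "s \<in> m ` {0<..}"
      using bij that by (simp add: bij_betw_def)
    have u: "0 < ?u" "m ?u = s"
      using inv_into_into[OF img] f_inv_into_f[OF img] by auto
    have iff: "m u \<le> s \<longleftrightarrow> u \<le> ?u" if "0 < u" for u
      using smono[of u ?u] smono[of ?u u] u that by (cases u ?u rule: linorder_cases) auto
    have "{u. 0 < u \<and> (\<exists>D\<le>s. (M has_real_derivative D) (at u))} = {u. 0 < u \<and> m u \<le> s}"
      using der DERIV_unique by blast
    also have "\<dots> = {0<..?u}"
      using iff by auto
    finally have "deriv_inv M s = (SUP u \<in> {0<..?u}. ennreal u)"
      by (simp only: deriv_inv_def)
    also have "\<dots> = ennreal ?u"
    proof (rule antisym)
      show "(SUP u \<in> {0<..?u}. ennreal u) \<le> ennreal ?u"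
        by (rule SUP_least) (simp add: ennreal_leI)
      show "ennreal ?u \<le> (SUP u \<in> {0<..?u}. ennreal u)"
        using u(1) by (intro SUP_upper) simp
    qed
    finally show ?thesis .
  qed
  show ?thesis
    unfolding orlicz_dual_def
  proof (rule nn_integral_cong_AE)
    show "AE s in lborel. deriv_inv M s * indicator {0..\<bar>t\<bar>} s
        = ennreal (inv_into {0<..} m s) * indicator {0..\<bar>t\<bar>} s"
      using AE_lborel_singleton[of "0::real"]
      by eventually_elim (auto simp: indicator_def eq)
  qed
qed

end

theory Submission
  imports Defs
begin

text \<open>
  Let \<open>G\<close> be the inverse of the dual function.  Substituting \<open>\<bar>y\<^sub>i\<bar> = G s\<^sub>i\<close>, the norm of \<open>x\<close> is the
  supremum of \<open>\<Sum>\<bar>x\<^sub>i\<bar> G s\<^sub>i\<close> over the simplex \<open>s\<^sub>i \<ge> 0\<close>, \<open>\<Sum>s\<^sub>i \<le> 1\<close>.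

  Upper bound: choose integers \<open>l\<^sub>i\<close> with \<open>\<Sum>l\<^sub>i = n\<close> maximising \<open>F = \<Sum>\<bar>x\<^sub>i\<bar> G(l\<^sub>i/n)\<close>, and split the
  entries \<open>\<bar>x\<^sub>i\<bar> a\<^sub>j\<close> according to whether \<open>j < l\<^sub>i\<close>.  The first part contributes at most its mean,
  which is at most \<open>F\<close>, and the second at most the square root of the mean of its squares.  By an
  exchange argument no increment \<open>n \<bar>x\<^sub>i\<bar> (G((l\<^sub>i+1)/n) - G(l\<^sub>i/n))\<close> exceeds \<open>F\<close>, which bounds the
  second part by \<open>\<surd>3 F\<close>; and \<open>1 + \<surd>3 \<le> 2\<surd>2\<close>.

  Lower bound: for each \<open>s\<^sub>i\<close> there is a test function \<open>u\<^sub>i\<close> on the columns with values in \<open>[0, 1]\<close>,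
  mean square at most \<open>s\<^sub>i\<close>, and mean of \<open>a u\<^sub>i\<close> at least a constant times \<open>G s\<^sub>i\<close>: either the indicator
  of the first \<open>l\<^sub>i\<close> columns or a multiple of \<open>a\<close> restricted to the other columns, depending on
  which of the two terms in \<open>G(l\<^sub>i/n)\<close> dominates.  The vector \<open>(u\<^sub>i(\<pi> i))\<^sub>i\<close> has mean square norm at
  most \<open>1\<close>, and since its entries are at most \<open>1\<close> this stays bounded after weighting with the inner
  product against \<open>(\<bar>x\<^sub>i\<bar> a\<^bsub>\<pi> i\<^esub>)\<^sub>i\<close>, so that pairing with it bounds the average norm from below.
\<close>

section \<open>Averages over random permutations\<close>

lemma sum_permutes_apply:
  fixes f :: "'a \<Rightarrow> real"
  assumes "finite S" "i \<in> S"
  shows "(\<Sum>p | p permutes S. f (p i)) = fact (card S - 1) * (\<Sum>j\<in>S. f j)"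
proof -
  have S: "insert i (S - {i}) = S" using assms by auto
  have "(\<Sum>p | p permutes insert i (S - {i}). f (p i))
      = (\<Sum>b\<in>insert i (S - {i}). \<Sum>q | q permutes S - {i}. f ((Transposition.transpose i b \<circ> q) i))"
    by (rule sum_over_permutations_insert) (use assms in auto)
  also have "\<dots> = (\<Sum>b\<in>S. \<Sum>q | q permutes S - {i}. f b)"
    unfolding S by (intro sum.cong) (auto simp: permutes_not_in)
  also have "\<dots> = fact (card S - 1) * (\<Sum>j\<in>S. f j)"
    using assms card_permutations[OF refl, of "S - {i}"] by (simp add: sum_distrib_left)
  finally show ?thesis unfolding S .
qed

text \<open>Given \<open>p i = b\<close>, the value \<open>p k\<close> is uniform on the points
  other than \<open>b\<close>. Since \<open>f\<close> and \<open>g\<close> are nonnegative, letting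
  it range over all of \<open>S\<close> only enlarges the sum and decouples the two factors.\<close>

lemma sum_permutes_apply2_le:
  fixes f g :: "'a \<Rightarrow> real"
  assumes "finite S" "i \<in> S" "k \<in> S" "i \<noteq> k" "\<And>j. j \<in> S \<Longrightarrow> 0 \<le> f j" "\<And>j. j \<in> S \<Longrightarrow> 0 \<le> g j"
  shows "(\<Sum>p | p permutes S. f (p i) * g (p k)) \<le> fact (card S - 2) * ((\<Sum>j\<in>S. f j) * (\<Sum>j\<in>S. g j))"
proof -
  have S: "insert i (S - {i}) = S" using assms by auto
  have "(\<Sum>p | p permutes insert i (S - {i}). f (p i) * g (p k))
      = (\<Sum>b\<in>insert i (S - {i}). \<Sum>q | q permutes S - {i}.
           f ((Transposition.transpose i b \<circ> q) i) * g ((Transposition.transpose i b \<circ> q) k))"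
    by (rule sum_over_permutations_insert) (use assms in auto)
  also have "\<dots> = (\<Sum>b\<in>S. \<Sum>q | q permutes S - {i}. f b * g (Transposition.transpose i b (q k)))"
    unfolding S by (intro sum.cong) (auto simp: permutes_not_in)
  also have "\<dots> = (\<Sum>b\<in>S. f b * (fact (card S - 2) * (\<Sum>h\<in>S - {i}. g (Transposition.transpose i b h))))"
  proof (rule sum.cong[OF refl])
    fix b assume "b \<in> S"
    have "card (S - {i}) - 1 = card S - 2" using assms by simp
    then show "(\<Sum>q | q permutes S - {i}. f b * g (Transposition.transpose i b (q k)))
        = f b * (fact (card S - 2) * (\<Sum>h\<in>S - {i}. g (Transposition.transpose i b h)))"
      using sum_permutes_apply[of "S - {i}" k "\<lambda>h. g (Transposition.transpose i b h)"] assms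
      by (simp add: sum_distrib_left[symmetric])
  qed
  also have "\<dots> \<le> (\<Sum>b\<in>S. f b * (fact (card S - 2) * (\<Sum>h\<in>S. g h)))"
  proof (intro sum_mono mult_left_mono)
    fix b assume b: "b \<in> S"
    have "(\<Sum>h\<in>S - {i}. g (Transposition.transpose i b h)) = (\<Sum>h\<in>Transposition.transpose i b ` (S - {i}). g h)"
      by (subst sum.reindex) simp_all
    also have "\<dots> \<le> (\<Sum>h\<in>S. g h)"
      using assms b by (intro sum_mono2) (auto simp: Transposition.transpose_def)
    finally show "(\<Sum>h\<in>S - {i}. g (Transposition.transpose i b h)) \<le> (\<Sum>h\<in>S. g h)" .
  qed (use assms in auto)
  also have "\<dots> = fact (card S - 2) * ((\<Sum>j\<in>S. f j) * (\<Sum>j\<in>S. g j))"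
    unfolding sum_distrib_right[symmetric] by simp
  finally show ?thesis unfolding S .
qed

text \<open>
  The inner product is at most \<open>\<parallel>u\<parallel> \<parallel>v\<parallel>\<close>, and \<open>(12 - \<parallel>u\<parallel>\<^sup>2) / 16\<close> is the tangent to \<open>1 / \<parallel>u\<parallel>\<close>, as a
  convex function of \<open>\<parallel>u\<parallel>\<^sup>2\<close>, at \<open>\<parallel>u\<parallel>\<^sup>2 = 4\<close>.
\<close>
lemma inner_times_le_norm:
  fixes u v :: "'a \<Rightarrow> real"
  assumes "\<And>i. i \<in> I \<Longrightarrow> 0 \<le> u i" "\<And>i. i \<in> I \<Longrightarrow> 0 \<le> v i"
  shows "(\<Sum>i\<in>I. v i * u i) * (12 - (\<Sum>i\<in>I. (u i)\<^sup>2)) / 16 \<le> sqrt (\<Sum>i\<in>I. (v i)\<^sup>2)"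
proof -
  define k where "k = sqrt (\<Sum>i\<in>I. (u i)\<^sup>2)"
  define V where "V = sqrt (\<Sum>i\<in>I. (v i)\<^sup>2)"
  have k: "0 \<le> k" "k\<^sup>2 = (\<Sum>i\<in>I. (u i)\<^sup>2)" by (auto simp: k_def sum_nonneg)
  have V: "0 \<le> V" by (simp add: V_def sum_nonneg)
  define p where "p = (\<Sum>i\<in>I. v i * u i)"
  have p0: "0 \<le> p" unfolding p_def by (intro sum_nonneg mult_nonneg_nonneg assms)
  have "p\<^sup>2 \<le> (V * k)\<^sup>2"
    using Cauchy_Schwarz_ineq_sum[of v u I] k
    by (simp add: p_def V_def power_mult_distrib sum_nonneg)
  then have pV: "p \<le> V * k" by (rule power2_le_imp_le) (use V k(1) in simp)
  show ?thesis
  proof (cases "k\<^sup>2 \<le> 12")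
    case True
    have "0 \<le> (k - 2)\<^sup>2 * (k + 4)" using k by simp
    then have "k * (12 - k\<^sup>2) \<le> 16" by (simp add: power2_eq_square algebra_simps)
    then have "V * (k * (12 - k\<^sup>2)) \<le> V * 16" using V by (rule mult_left_mono)
    moreover have "p * (12 - k\<^sup>2) \<le> V * k * (12 - k\<^sup>2)" using pV True by (intro mult_right_mono) auto
    ultimately show ?thesis by (simp add: p_def[symmetric] V_def[symmetric] k(2)[symmetric] mult.assoc)
  next
    case False
    then have "p * (12 - k\<^sup>2) \<le> 0" using p0 by (simp add: mult_nonneg_nonpos)
    then show ?thesis using V by (simp add: p_def[symmetric] V_def[symmetric] k(2)[symmetric])
  qed
qed

text \<open>Average \<open>inner_times_le_norm\<close> over \<open>p\<close>. In units of the mean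
  inner product, the mean of the inner product times the squared norm of \<open>u\<close> is at most
  3: the diagonal terms give at most 1 because \<open>u\<close> is at most 1, and the off-diagonal
  ones at most n/(n-1), which is at most 2. Hence the constant (12 - 3)/16 = 9/16.\<close>

lemma permutation_average_ge:
  fixes b u :: "nat \<Rightarrow> nat \<Rightarrow> real"
  assumes n: "2 \<le> n"
    and b: "\<And>i j. i < n \<Longrightarrow> j < n \<Longrightarrow> 0 \<le> b i j"
    and u: "\<And>i j. i < n \<Longrightarrow> j < n \<Longrightarrow> 0 \<le> u i j \<and> u i j \<le> 1"
    and u2: "(\<Sum>i<n. \<Sum>j<n. (u i j)\<^sup>2) \<le> n"
  shows "9 / 16 * ((\<Sum>i<n. \<Sum>j<n. b i j * u i j) / n)
     \<le> (\<Sum>p | p permutes {..<n}. sqrt (\<Sum>i<n. (b i (p i))\<^sup>2)) / fact n"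
proof -
  let ?P = "{p. p permutes {..<n}}"
  have P: "p i < n" if "p \<in> ?P" "i < n" for p i
    using that permutes_in_image[of p "{..<n}" i] by simp
  define B where "B = (\<lambda>i. \<Sum>j<n. b i j * u i j)"
  have B0: "0 \<le> B i" if "i < n" for i
    unfolding B_def using that b u by (intro sum_nonneg mult_nonneg_nonneg) auto
  have E1: "(\<Sum>p\<in>?P. b i (p i) * u i (p i)) = fact (n - 1) * B i" if "i < n" for i
    using sum_permutes_apply[of "{..<n}" i "\<lambda>j. b i j * u i j"] that by (simp add: B_def)
  have fct: "fact (n - 1) = (real n - 1) * fact (n - 2)"
    using n by (subst fact_reduce) (auto simp: of_nat_diff numeral_2_eq_2)
  have fctn: "fact n = real n * fact (n - 1)"
    using n by (subst fact_reduce) auto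
  have E2: "(\<Sum>p\<in>?P. (b i (p i) * u i (p i)) * (\<Sum>k<n. (u k (p k))\<^sup>2)) \<le> 3 * fact (n - 1) * B i"
    if i: "i < n" for i
  proof -
    have "(\<Sum>p\<in>?P. (b i (p i) * u i (p i)) * (\<Sum>k<n. (u k (p k))\<^sup>2))
      = (\<Sum>k<n. \<Sum>p\<in>?P. (b i (p i) * u i (p i)) * (u k (p k))\<^sup>2)"
      unfolding sum_distrib_left by (rule sum.swap)
    also have "\<dots> = (\<Sum>p\<in>?P. (b i (p i) * u i (p i)) * (u i (p i))\<^sup>2)
        + (\<Sum>k\<in>{..<n} - {i}. \<Sum>p\<in>?P. (b i (p i) * u i (p i)) * (u k (p k))\<^sup>2)"
      using i by (subst sum.remove[of _ i]) auto
    also have "\<dots> \<le> fact (n - 1) * B i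
        + (\<Sum>k\<in>{..<n} - {i}. fact (n - 2) * (B i * (\<Sum>h<n. (u k h)\<^sup>2)))"
    proof (intro add_mono sum_mono)
      have "(\<Sum>p\<in>?P. (b i (p i) * u i (p i)) * (u i (p i))\<^sup>2) \<le> (\<Sum>p\<in>?P. b i (p i) * u i (p i))"
        using i u b P by (intro sum_mono mult_left_le mult_nonneg_nonneg) (auto simp: power_le_one)
      then show "(\<Sum>p\<in>?P. (b i (p i) * u i (p i)) * (u i (p i))\<^sup>2) \<le> fact (n - 1) * B i"
        using E1[OF i] by simp
    next
      fix k assume "k \<in> {..<n} - {i}"
      then show "(\<Sum>p\<in>?P. (b i (p i) * u i (p i)) * (u k (p k))\<^sup>2)
          \<le> fact (n - 2) * (B i * (\<Sum>h<n. (u k h)\<^sup>2))"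
        using sum_permutes_apply2_le[of "{..<n}" i k "\<lambda>j. b i j * u i j" "\<lambda>h. (u k h)\<^sup>2"] i b u
        by (simp add: B_def)
    qed
    also have "\<dots> \<le> fact (n - 1) * B i + fact (n - 2) * (B i * n)"
    proof -
      have "(\<Sum>k\<in>{..<n} - {i}. \<Sum>h<n. (u k h)\<^sup>2) \<le> (\<Sum>k<n. \<Sum>h<n. (u k h)\<^sup>2)"
        by (intro sum_mono2) (auto intro: sum_nonneg)
      with u2 have "(\<Sum>k\<in>{..<n} - {i}. \<Sum>h<n. (u k h)\<^sup>2) \<le> n" by linarith
      then show ?thesis
        unfolding sum_distrib_left[symmetric] using B0[OF i]
        by (intro add_mono mult_left_mono) auto
    qed
    also have "\<dots> \<le> fact (n - 1) * B i + 2 * fact (n - 1) * B i"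
    proof -
      have "fact (n - 2) * real n \<le> fact (n - 2) * (2 * (real n - 1))"
        using n by (intro mult_left_mono) auto
      then have "fact (n - 2) * real n * B i \<le> 2 * fact (n - 1) * B i"
        unfolding fct using B0[OF i] by (intro mult_right_mono) (auto simp: algebra_simps)
      then show ?thesis by (simp add: algebra_simps)
    qed
    finally show ?thesis by (simp add: algebra_simps)
  qed
  have "9 / 16 * fact (n - 1) * (\<Sum>i<n. B i)
    = (\<Sum>i<n. 12 / 16 * (fact (n - 1) * B i) - (3 * fact (n - 1) * B i) / 16)"
    unfolding sum_distrib_left by (intro sum.cong) auto
  also have "\<dots> \<le> (\<Sum>i<n. 12 / 16 * (\<Sum>p\<in>?P. b i (p i) * u i (p i))
      - (\<Sum>p\<in>?P. (b i (p i) * u i (p i)) * (\<Sum>k<n. (u k (p k))\<^sup>2)) / 16)"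
    using E1 E2 by (intro sum_mono diff_mono divide_right_mono) auto
  also have "\<dots> = (\<Sum>i<n. \<Sum>p\<in>?P. (b i (p i) * u i (p i)) * (12 - (\<Sum>k<n. (u k (p k))\<^sup>2)) / 16)"
    by (simp add: sum_distrib_left sum_divide_distrib sum_subtractf[symmetric] algebra_simps diff_divide_distrib
        del: sum_subtractf)
  also have "\<dots> = (\<Sum>p\<in>?P. (\<Sum>i<n. b i (p i) * u i (p i)) * (12 - (\<Sum>k<n. (u k (p k))\<^sup>2)) / 16)"
    unfolding sum_distrib_right sum_divide_distrib by (rule sum.swap)
  also have "\<dots> \<le> (\<Sum>p\<in>?P. sqrt (\<Sum>i<n. (b i (p i))\<^sup>2))"
    using b u P by (intro sum_mono inner_times_le_norm) auto
  finally have "9 / 16 * fact (n - 1) * (\<Sum>i<n. B i) / fact n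
      \<le> (\<Sum>p\<in>?P. sqrt (\<Sum>i<n. (b i (p i))\<^sup>2)) / fact n"
    by (rule divide_right_mono) simp
  moreover have "9 / 16 * fact (n - 1) * (\<Sum>i<n. B i) / fact n = 9 / 16 * ((\<Sum>i<n. B i) / n)"
    unfolding fctn using n by (simp add: field_simps)
  ultimately show ?thesis by (simp add: B_def)
qed

text \<open>Split \<open>b\<close> at column \<open>l i\<close> and use the triangle inequality. The
  l2 norm of the first part is bounded by its l1 norm, whose mean is explicit. For the second part,
  Cauchy-Schwarz bounds the mean of the square root by the square root of the mean.\<close>

lemma permutation_average_le:
  fixes b :: "nat \<Rightarrow> nat \<Rightarrow> real" and l :: "nat \<Rightarrow> nat"
  assumes n: "1 \<le> n"
    and b: "\<And>i j. i < n \<Longrightarrow> j < n \<Longrightarrow> 0 \<le> b i j"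
    and l: "\<And>i. i < n \<Longrightarrow> l i \<le> n"
  shows "(\<Sum>p | p permutes {..<n}. sqrt (\<Sum>i<n. (b i (p i))\<^sup>2)) / fact n
    \<le> (\<Sum>i<n. \<Sum>j<l i. b i j) / n + sqrt ((\<Sum>i<n. \<Sum>j\<in>{l i..<n}. (b i j)\<^sup>2) / n)"
proof -
  let ?P = "{p. p permutes {..<n}}"
  have P: "p i < n" if "p \<in> ?P" "i < n" for p i
    using that permutes_in_image[of p "{..<n}" i] by simp
  have cardP: "real (card ?P) = fact n" using card_permutations[OF refl, of "{..<n}"] by simp
  have fctn: "fact n = real n * fact (n - 1)"
    using n by (subst fact_reduce) auto
  define c where "c i j = (if j < l i then b i j else 0)" for i j
  define d where "d i j = (if j < l i then 0 else b i j)" for i j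
  have bcd: "b i j = c i j + d i j" for i j by (auto simp: c_def d_def)
  have c0: "0 \<le> c i j" if "i < n" "j < n" for i j using b[OF that] by (auto simp: c_def)
  define Y where "Y p = (\<Sum>i<n. (d i (p i))\<^sup>2)" for p :: "nat \<Rightarrow> nat"
  have Y0: "0 \<le> Y p" for p by (simp add: Y_def sum_nonneg)
  have avg: "(\<Sum>p\<in>?P. \<Sum>i<n. f i (p i)) = fact (n - 1) * (\<Sum>i<n. \<Sum>j<n. f i j)"
    for f :: "nat \<Rightarrow> nat \<Rightarrow> real"
    by (subst sum.swap) (simp add: sum_permutes_apply sum_distrib_left)
  have pt: "sqrt (\<Sum>i<n. (b i (p i))\<^sup>2) \<le> (\<Sum>i<n. c i (p i)) + sqrt (Y p)" if p: "p \<in> ?P" for p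
  proof -
    have "sqrt (\<Sum>i<n. (b i (p i))\<^sup>2) \<le> L2_set (\<lambda>i. c i (p i)) {..<n} + L2_set (\<lambda>i. d i (p i)) {..<n}"
      using L2_set_triangle_ineq[of "\<lambda>i. c i (p i)" "\<lambda>i. d i (p i)" "{..<n}"]
      by (simp add: bcd L2_set_def)
    moreover have "L2_set (\<lambda>i. c i (p i)) {..<n} \<le> (\<Sum>i<n. c i (p i))"
      using c0 P[OF p] by (intro L2_set_le_sum) auto
    ultimately show ?thesis by (simp add: Y_def L2_set_def)
  qed
  have "(\<Sum>p\<in>?P. 1 * sqrt (Y p))\<^sup>2 \<le> (\<Sum>p\<in>?P. 1\<^sup>2) * (\<Sum>p\<in>?P. (sqrt (Y p))\<^sup>2)"
    by (rule Cauchy_Schwarz_ineq_sum)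
  then have cs: "(\<Sum>p\<in>?P. sqrt (Y p))\<^sup>2 \<le> fact n * (\<Sum>p\<in>?P. Y p)"
    using Y0 cardP by simp
  have "(\<Sum>p\<in>?P. sqrt (Y p)) / fact n \<le> sqrt ((\<Sum>p\<in>?P. Y p) / fact n)"
  proof (rule real_le_rsqrt)
    have "((\<Sum>p\<in>?P. sqrt (Y p)) / fact n)\<^sup>2 \<le> (fact n * (\<Sum>p\<in>?P. Y p)) / (fact n)\<^sup>2"
      unfolding power_divide by (rule divide_right_mono[OF cs]) simp
    then show "((\<Sum>p\<in>?P. sqrt (Y p)) / fact n)\<^sup>2 \<le> (\<Sum>p\<in>?P. Y p) / fact n"
      by (simp add: power2_eq_square)
  qed
  also have "(\<Sum>p\<in>?P. Y p) / fact n = (\<Sum>i<n. \<Sum>j<n. (d i j)\<^sup>2) / n"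
    unfolding Y_def avg[of "\<lambda>i j. (d i j)\<^sup>2"] fctn by simp
  also have "(\<Sum>i<n. \<Sum>j<n. (d i j)\<^sup>2) = (\<Sum>i<n. \<Sum>j\<in>{l i..<n}. (b i j)\<^sup>2)"
    by (intro sum.cong sum.mono_neutral_cong_right refl) (auto simp: d_def)
  finally have part2: "(\<Sum>p\<in>?P. sqrt (Y p)) / fact n \<le> sqrt ((\<Sum>i<n. \<Sum>j\<in>{l i..<n}. (b i j)\<^sup>2) / n)" .
  have "(\<Sum>p\<in>?P. \<Sum>i<n. c i (p i)) / fact n = (\<Sum>i<n. \<Sum>j<n. c i j) / n"
    unfolding avg fctn by simp
  also have "(\<Sum>i<n. \<Sum>j<n. c i j) = (\<Sum>i<n. \<Sum>j<l i. b i j)"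
  proof (intro sum.cong[OF refl] sum.mono_neutral_cong_right)
    fix i assume "i \<in> {..<n}"
    then show "{..<l i} \<subseteq> {..<n}" using l[of i] by auto
  qed (auto simp: c_def)
  finally have part1: "(\<Sum>p\<in>?P. \<Sum>i<n. c i (p i)) / fact n = (\<Sum>i<n. \<Sum>j<l i. b i j) / n" .
  have "(\<Sum>p\<in>?P. sqrt (\<Sum>i<n. (b i (p i))\<^sup>2)) / fact n
      \<le> (\<Sum>p\<in>?P. (\<Sum>i<n. c i (p i)) + sqrt (Y p)) / fact n"
    by (intro divide_right_mono sum_mono pt) auto
  also have "\<dots> = (\<Sum>p\<in>?P. \<Sum>i<n. c i (p i)) / fact n + (\<Sum>p\<in>?P. sqrt (Y p)) / fact n"
    by (simp add: sum.distrib add_divide_distrib)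
  finally show ?thesis using part1 part2 by linarith
qed


section \<open>The prescribed values of the inverse dual function at the points l/n\<close>

definition orlicz_node :: "nat \<Rightarrow> (nat \<Rightarrow> real) \<Rightarrow> nat \<Rightarrow> real" where
  "orlicz_node n a l = sqrt (((1 / real n) * (\<Sum>i<l. a i))\<^sup>2
      + (real l / real n) * ((1 / real n) * (\<Sum>i\<in>{l..<n}. (a i)\<^sup>2)))"

lemma orlicz_node_0 [simp]: "orlicz_node n a 0 = 0"
  by (simp add: orlicz_node_def)

lemma orlicz_node_nonneg: "0 \<le> orlicz_node n a l"
  by (simp add: orlicz_node_def sum_nonneg)

lemma orlicz_node_sq:
  "(orlicz_node n a l)\<^sup>2 = ((\<Sum>i<l. a i)\<^sup>2 + l * (\<Sum>i\<in>{l..<n}. (a i)\<^sup>2)) / (real n)\<^sup>2"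
  by (simp add: orlicz_node_def sum_nonneg power2_eq_square add_divide_distrib)

lemma mean_le_orlicz_node: "(\<Sum>i<l. a i) / n \<le> orlicz_node n a l"
proof (rule power2_le_imp_le[OF _ orlicz_node_nonneg])
  show "((\<Sum>i<l. a i) / n)\<^sup>2 \<le> (orlicz_node n a l)\<^sup>2"
    unfolding orlicz_node_sq power_divide by (intro divide_right_mono) (auto simp: sum_nonneg)
qed

locale decreasing_weights =
  fixes n :: nat and a :: "nat \<Rightarrow> real"
  assumes decreasing: "i \<le> j \<Longrightarrow> j < n \<Longrightarrow> a j \<le> a i"
    and nonneg: "i < n \<Longrightarrow> 0 \<le> a i"
begin

abbreviation g :: "nat \<Rightarrow> real" where "g \<equiv> orlicz_node n a"

lemma mult_le_partial_sum:
  assumes "l \<le> j" "j < n"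
  shows "l * a j \<le> (\<Sum>i<l. a i)"
  using sum_bounded_below[of "{..<l}" "a j" a] assms decreasing by auto

text \<open>The quotient \<open>g l / l\<close> does not increase: appending a smaller weight lowers
  the mean of the first weights, and the tail sum divided by \<open>l\<close> decreases too. This
  stands in for concavity: it bounds the next increment of \<open>g\<close> by
  \<open>g l / l\<close>.\<close>

lemma node_Suc_le:
  assumes l: "l < n"
  shows "l * g (Suc l) \<le> Suc l * g l"
proof -
  define A where "A = (\<Sum>i<l. a i)"
  define Q where "Q = (\<Sum>i\<in>{Suc l..<n}. (a i)\<^sup>2)"
  have A: "l * a l \<le> A" unfolding A_def using mult_le_partial_sum[of l l] l by simp
  have al: "0 \<le> a l" using nonneg l by simp
  have A0: "0 \<le> A" using A al by (meson mult_nonneg_nonneg of_nat_0_le_iff order_trans)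
  have Q0: "0 \<le> Q" unfolding Q_def by (intro sum_nonneg) auto
  have Ql: "(\<Sum>i\<in>{l..<n}. (a i)\<^sup>2) = (a l)\<^sup>2 + Q"
    unfolding Q_def using l by (simp add: sum.atLeast_Suc_lessThan)
  have "(l * (A + a l))\<^sup>2 \<le> (Suc l * A)\<^sup>2"
    using A A0 al by (intro power_mono) (auto simp: algebra_simps)
  moreover have "(real l)\<^sup>2 * (Suc l * Q) \<le> (real (Suc l))\<^sup>2 * (l * ((a l)\<^sup>2 + Q))"
  proof -
    have "l * (Suc l * real l) * Q \<le> Suc l * (Suc l * real l) * ((a l)\<^sup>2 + Q)"
      using Q0 by (intro mult_mono) auto
    then show ?thesis by (simp only: power2_eq_square) (simp only: ac_simps)
  qed
  ultimately have "(real l)\<^sup>2 * ((A + a l)\<^sup>2 + Suc l * Q) \<le> (real (Suc l))\<^sup>2 * (A\<^sup>2 + l * ((a l)\<^sup>2 + Q))"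
    unfolding power_mult_distrib distrib_left[of "(real l)\<^sup>2"] distrib_left[of "(real (Suc l))\<^sup>2" "A\<^sup>2"]
    by (rule add_mono)
  then have "(l * g (Suc l))\<^sup>2 \<le> (Suc l * g l)\<^sup>2"
    unfolding power_mult_distrib orlicz_node_sq Ql
    by (simp add: A_def[symmetric] Q_def[symmetric] divide_right_mono)
  then show ?thesis
    by (rule power2_le_imp_le) (simp add: orlicz_node_nonneg)
qed

text \<open>With \<open>A\<close> and \<open>Q\<close> as below, n^2 times the difference of squares
  is \<open>2 * A * a l + (a l)^2 + Q - l * (a l)^2\<close>, and \<open>l * a l\<close> is at most
  \<open>A\<close>. This turns the squares of discarded entries into increments of \<open>g\<close>,
  which the exchange argument controls.\<close>

lemma tail_le_node_sq_diff:
  assumes l: "l < n"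
  shows "(\<Sum>i\<in>{l..<n}. (a i)\<^sup>2) / n \<le> n * ((g (Suc l))\<^sup>2 - (g l)\<^sup>2)"
proof -
  define A where "A = (\<Sum>i<l. a i)"
  define Q where "Q = (\<Sum>i\<in>{Suc l..<n}. (a i)\<^sup>2)"
  have A: "l * a l \<le> A" unfolding A_def using mult_le_partial_sum[of l l] l by simp
  have al: "0 \<le> a l" using nonneg l by simp
  have A0: "0 \<le> A" using A al by (meson mult_nonneg_nonneg of_nat_0_le_iff order_trans)
  have Ql: "(\<Sum>i\<in>{l..<n}. (a i)\<^sup>2) = (a l)\<^sup>2 + Q"
    unfolding Q_def using l by (simp add: sum.atLeast_Suc_lessThan)
  have "l * a l * a l \<le> A * a l" using A al by (rule mult_right_mono)
  moreover have "0 \<le> A * a l" using A0 al by simp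
  ultimately have "(a l)\<^sup>2 + Q \<le> (A + a l)\<^sup>2 + Suc l * Q - (A\<^sup>2 + l * ((a l)\<^sup>2 + Q))"
    by (simp add: power2_eq_square algebra_simps)
  then have "((a l)\<^sup>2 + Q) / n \<le> ((A + a l)\<^sup>2 + Suc l * Q - (A\<^sup>2 + l * ((a l)\<^sup>2 + Q))) / n"
    by (rule divide_right_mono) simp
  also have "\<dots> = n * ((g (Suc l))\<^sup>2 - (g l)\<^sup>2)"
    unfolding orlicz_node_sq Ql using l
    by (simp add: A_def[symmetric] Q_def[symmetric] diff_divide_distrib[symmetric] power2_eq_square[of "real n"])
  finally show ?thesis unfolding Ql .
qed

lemma node_mono_Suc:
  assumes "l < n"
  shows "g l \<le> g (Suc l)"
proof -
  have "0 \<le> n * ((g (Suc l))\<^sup>2 - (g l)\<^sup>2)"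
    using tail_le_node_sq_diff[OF assms] by (rule order_trans[rotated]) (simp add: sum_nonneg)
  then have "(g l)\<^sup>2 \<le> (g (Suc l))\<^sup>2" using assms by (simp add: zero_le_mult_iff)
  then show ?thesis by (rule power2_le_imp_le[OF _ orlicz_node_nonneg])
qed

text \<open>Up to the factor n^2, the square of \<open>g l\<close> is \<open>A^2 + l * Q\<close>.
  The larger term is at least half of the sum, which gives \<open>sqrt 2\<close>; \<open>t\<close>
  in \<open>gl\<close> is the inner product attained by the test function for that term.\<close>

lemma node_test_function:
  assumes l: "1 \<le> l" "l \<le> n"
  obtains u :: "nat \<Rightarrow> real" where "\<And>j. j < n \<Longrightarrow> 0 \<le> u j \<and> u j \<le> 1" "(\<Sum>j<n. (u j)\<^sup>2) \<le> l"
    "g l \<le> sqrt 2 * ((\<Sum>j<n. a j * u j) / n)"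
proof -
  define A where "A = (\<Sum>i<l. a i)"
  define Q where "Q = (\<Sum>i\<in>{l..<n}. (a i)\<^sup>2)"
  have n: "0 < n" using l by simp
  have A0: "0 \<le> A" unfolding A_def using nonneg l by (intro sum_nonneg) auto
  have Q0: "0 \<le> Q" unfolding Q_def by (intro sum_nonneg) auto
  have gl: "g l \<le> sqrt 2 * (t / n)" if "A\<^sup>2 + l * Q \<le> 2 * t\<^sup>2" "0 \<le> t" for t
  proof (rule power2_le_imp_le)
    show "(g l)\<^sup>2 \<le> (sqrt 2 * (t / n))\<^sup>2"
      unfolding orlicz_node_sq power_mult_distrib power_divide using that(1)
      by (simp add: A_def[symmetric] Q_def[symmetric] divide_right_mono)
  qed (use that in auto)
  show thesis
  proof (cases "l * Q \<le> A\<^sup>2")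
    case True
    define u where "u j = (if j < l then 1 else 0 :: real)" for j
    have "(\<Sum>j<n. (u j)\<^sup>2) = (\<Sum>j<l. 1)"
      using l by (intro sum.mono_neutral_cong_right) (auto simp: u_def)
    moreover have "(\<Sum>j<n. a j * u j) = A"
      unfolding A_def using l by (intro sum.mono_neutral_cong_right) (auto simp: u_def)
    ultimately show ?thesis
      using gl[of A] True A0 by (intro that[of u]) (auto simp: u_def)
  next
    case False
    then have Qpos: "0 < Q" using Q0 A0 by (cases "Q = 0") auto
    \<comment> \<open>Normalised so that the squares sum to exactly \<open>l\<close>; the inner
      product with \<open>a\<close> is then \<open>c * Q\<close>, whose square is
      \<open>l * Q\<close>.\<close>
    define c where "c = sqrt (l / Q)"
    have c: "0 \<le> c" "c\<^sup>2 * Q = l" using Qpos by (auto simp: c_def)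
    define u where "u j = (if j < l then 0 else c * a j)" for j
    have sq: "(\<Sum>j<n. (u j)\<^sup>2) = (\<Sum>j\<in>{l..<n}. c\<^sup>2 * (a j)\<^sup>2)"
      by (intro sum.mono_neutral_cong_right) (auto simp: u_def power_mult_distrib)
    have ip: "(\<Sum>j<n. a j * u j) = (\<Sum>j\<in>{l..<n}. c * (a j)\<^sup>2)"
      by (intro sum.mono_neutral_cong_right) (auto simp: u_def power2_eq_square)
    \<comment> \<open>The failed case condition is what keeps the test function below 1:
      \<open>l * a j\<close> is at most \<open>A\<close>, and \<open>A^2\<close> is less than
      \<open>l * Q\<close>.\<close>
    have le1: "c * a j \<le> 1" if j: "l \<le> j" "j < n" for j
    proof -
      have "(l * a j)\<^sup>2 \<le> A\<^sup>2"
        using mult_le_partial_sum[OF j] nonneg[OF j(2)] unfolding A_def by (intro power_mono) auto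
      also have "\<dots> \<le> l * Q" using False by simp
      finally have "l * (a j)\<^sup>2 \<le> Q"
        using l by (simp add: power2_eq_square mult_ac)
      then have "(c * a j)\<^sup>2 \<le> 1\<^sup>2" using Qpos by (simp add: c_def power_mult_distrib divide_le_eq_1)
      then show ?thesis by (rule power2_le_imp_le) simp
    qed
    have "(c * Q)\<^sup>2 = l * Q"
      using c(2) by (simp add: power2_eq_square algebra_simps)
    then have "A\<^sup>2 + l * Q \<le> 2 * (c * Q)\<^sup>2" using False by linarith
    from gl[OF this] have "g l \<le> sqrt 2 * ((\<Sum>j<n. a j * u j) / n)"
      unfolding ip sum_distrib_left[symmetric] Q_def[symmetric] using c Q0 by simp
    moreover have "(\<Sum>j<n. (u j)\<^sup>2) \<le> l"
      unfolding sq sum_distrib_left[symmetric] Q_def[symmetric] using c by simp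
    moreover have "0 \<le> u j \<and> u j \<le> 1" if "j < n" for j
      using that le1 c nonneg by (auto simp: u_def)
    ultimately show ?thesis using that by blast
  qed
qed

text \<open>On the first interval, scale the test function of node 1 by \<open>t = n * s\<close>; as
  \<open>t\<close> is at most 1, \<open>t^2\<close> is at most \<open>t\<close>. On later intervals
  the increment of \<open>g\<close> is at most \<open>g m / m\<close>, hence at most
  \<open>g m\<close>, so the test function of the left node suffices at the cost of a factor
  2.\<close>

lemma interpolated_test_function:
  fixes s :: real
  assumes m: "m < n" "m \<le> n * s" "n * s \<le> Suc m"
  obtains u :: "nat \<Rightarrow> real" where "\<And>j. j < n \<Longrightarrow> 0 \<le> u j \<and> u j \<le> 1" "(\<Sum>j<n. (u j)\<^sup>2) \<le> n * s"
    "g m + (n * s - m) * (g (Suc m) - g m) \<le> 2 * sqrt 2 * ((\<Sum>j<n. a j * u j) / n)"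
proof (cases "m = 0")
  case True
  obtain v :: "nat \<Rightarrow> real" where v: "\<And>j. j < n \<Longrightarrow> 0 \<le> v j \<and> v j \<le> 1" "(\<Sum>j<n. (v j)\<^sup>2) \<le> 1"
    "g 1 \<le> sqrt 2 * ((\<Sum>j<n. a j * v j) / n)"
    using node_test_function[of 1] m by auto
  define t where "t = n * s"
  have t: "0 \<le> t" "t \<le> 1" using m True by (auto simp: t_def)
  have "t\<^sup>2 * (\<Sum>j<n. (v j)\<^sup>2) \<le> t * 1"
    using v(2) t by (intro mult_mono) (auto simp: power2_eq_square mult_left_le sum_nonneg)
  then have sq: "(\<Sum>j<n. (t * v j)\<^sup>2) \<le> t" by (simp add: power_mult_distrib sum_distrib_left)
  have "t * g 1 \<le> t * (2 * (sqrt 2 * ((\<Sum>j<n. a j * v j) / n)))"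
    using v(3) t orlicz_node_nonneg[of n a 1] by (intro mult_left_mono) auto
  then have "t * g 1 \<le> 2 * sqrt 2 * ((\<Sum>j<n. a j * (t * v j)) / n)"
    by (simp add: sum_distrib_left sum_divide_distrib algebra_simps)
  with sq show ?thesis
    using v(1) t True by (intro that[of "\<lambda>j. t * v j"]) (auto simp: t_def[symmetric] mult_le_one)
next
  case False
  obtain v :: "nat \<Rightarrow> real" where v: "\<And>j. j < n \<Longrightarrow> 0 \<le> v j \<and> v j \<le> 1" "(\<Sum>j<n. (v j)\<^sup>2) \<le> m"
    "g m \<le> sqrt 2 * ((\<Sum>j<n. a j * v j) / n)"
    using node_test_function[of m] m False by auto
  have "m * (g (Suc m) - g m) \<le> g m" using node_Suc_le[OF m(1)] by (simp add: algebra_simps)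
  moreover have "1 * (g (Suc m) - g m) \<le> m * (g (Suc m) - g m)"
    using False node_mono_Suc[OF m(1)] by (intro mult_right_mono) auto
  moreover have "(n * s - m) * (g (Suc m) - g m) \<le> 1 * (g (Suc m) - g m)"
    using m node_mono_Suc[OF m(1)] by (intro mult_right_mono) auto
  ultimately have "g m + (n * s - m) * (g (Suc m) - g m) \<le> 2 * g m" by linarith
  with v m show ?thesis by (intro that[of v]) auto
qed

section \<open>The two bounds in terms of the node values\<close>

lemma average_ge:
  fixes x s w :: "nat \<Rightarrow> real" and m :: "nat \<Rightarrow> nat"
  assumes n: "2 \<le> n" and x: "\<And>i. i < n \<Longrightarrow> 0 \<le> x i"
    and m: "\<And>i. i < n \<Longrightarrow> m i < n \<and> m i \<le> n * s i \<and> n * s i \<le> Suc (m i)"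
    and s: "(\<Sum>i<n. s i) \<le> 1"
    and w: "\<And>i. i < n \<Longrightarrow> w i = g (m i) + (n * s i - m i) * (g (Suc (m i)) - g (m i))"
  shows "(\<Sum>i<n. x i * w i)
    \<le> 4 * sqrt 5 * ((\<Sum>p | p permutes {..<n}. sqrt (\<Sum>i<n. (x i * a (p i))\<^sup>2)) / fact n)"
    (is "_ \<le> 4 * sqrt 5 * ?A")
proof -
  define good where "good i v \<longleftrightarrow> (\<forall>j<n. 0 \<le> v j \<and> v j \<le> 1) \<and> (\<Sum>j<n. (v j)\<^sup>2) \<le> n * s i
    \<and> w i \<le> 2 * sqrt 2 * ((\<Sum>j<n. a j * v j) / n)" for i and v :: "nat \<Rightarrow> real"
  have "\<exists>v. good i v" if i: "i < n" for i
  proof -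
    obtain v :: "nat \<Rightarrow> real" where v: "\<And>j. j < n \<Longrightarrow> 0 \<le> v j \<and> v j \<le> 1"
      "(\<Sum>j<n. (v j)\<^sup>2) \<le> n * s i"
      "g (m i) + (n * s i - m i) * (g (Suc (m i)) - g (m i)) \<le> 2 * sqrt 2 * ((\<Sum>j<n. a j * v j) / n)"
      by (rule interpolated_test_function[of "m i" "s i"]) (use m[OF i] in auto)
    have "good i v" unfolding good_def w[OF i] using v by (intro conjI) simp_all
    then show ?thesis by blast
  qed
  then have "\<forall>i. \<exists>v. i < n \<longrightarrow> good i v" by blast
  from choice[OF this] obtain u where "\<forall>i. i < n \<longrightarrow> good i (u i)" ..
  then have u: "\<And>i j. i < n \<Longrightarrow> j < n \<Longrightarrow> 0 \<le> u i j \<and> u i j \<le> 1"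
       "\<And>i. i < n \<Longrightarrow> (\<Sum>j<n. (u i j)\<^sup>2) \<le> n * s i"
       "\<And>i. i < n \<Longrightarrow> w i \<le> 2 * sqrt 2 * ((\<Sum>j<n. a j * u i j) / n)"
    unfolding good_def by blast+
  have "(\<Sum>i<n. \<Sum>j<n. (u i j)\<^sup>2) \<le> (\<Sum>i<n. n * s i)" using u(2) by (intro sum_mono) auto
  also have "\<dots> \<le> real n * 1" unfolding sum_distrib_left[symmetric] using s by (intro mult_left_mono) auto
  finally have "(\<Sum>i<n. \<Sum>j<n. (u i j)\<^sup>2) \<le> n" by simp
  from permutation_average_ge[OF n _ u(1) this, of "\<lambda>i j. x i * a j"]
  have A: "9 / 16 * ((\<Sum>i<n. \<Sum>j<n. x i * a j * u i j) / n) \<le> ?A" using x nonneg by auto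
  have A0: "0 \<le> ?A" by (intro divide_nonneg_nonneg sum_nonneg) (auto simp: sum_nonneg)
  have "(\<Sum>i<n. x i * w i) \<le> (\<Sum>i<n. x i * (2 * sqrt 2 * ((\<Sum>j<n. a j * u i j) / n)))"
    using u(3) x by (intro sum_mono mult_left_mono) auto
  also have "\<dots> = 2 * sqrt 2 * ((\<Sum>i<n. \<Sum>j<n. x i * a j * u i j) / n)"
    by (simp add: sum_distrib_left sum_divide_distrib algebra_simps)
  also have "\<dots> \<le> 2 * sqrt 2 * (16 / 9 * ?A)" using A by (intro mult_left_mono) auto
  also have "\<dots> \<le> 4 * sqrt 5 * ?A"
  proof -
    \<comment> \<open>The factor \<open>2 * sqrt 2\<close> comes from the test functions and 16/9
      from averaging; the squares are 2048/81 and 80.\<close>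
    have "2 * sqrt 2 * (16 / 9) \<le> 4 * sqrt 5"
      by (rule power2_le_imp_le) (auto simp: power_mult_distrib power_divide)
    from mult_right_mono[OF this A0] show ?thesis by simp
  qed
  finally show ?thesis .
qed

lemma average_le:
  fixes x :: "nat \<Rightarrow> real"
  assumes n: "1 \<le> n" and x: "\<And>i. i < n \<Longrightarrow> 0 \<le> x i"
  obtains l :: "nat \<Rightarrow> nat" where "(\<Sum>i<n. l i) = n"
    "(\<Sum>p | p permutes {..<n}. sqrt (\<Sum>i<n. (x i * a (p i))\<^sup>2)) / fact n
      \<le> 2 * sqrt 2 * (\<Sum>i<n. x i * g (l i))"
proof -
  define L :: "(nat \<Rightarrow> nat) set" where "L = {l. (\<Sum>i<n. l i) = n}"
  define F where "F l = (\<Sum>i<n. x i * g (l i))" for l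
  have L_le: "l i \<le> n" if "l \<in> L" "i < n" for l i
    using that member_le_sum[of i "{..<n}" l] by (auto simp: L_def)
  \<comment> \<open>\<open>L\<close> itself is infinite, since values outside \<open>{..<n}\<close>
    are free. \<open>F\<close> ignores them, so it still takes finitely many values and attains a
    maximum.\<close>
  have "F ` L \<subseteq> F ` ({..<n} \<rightarrow>\<^sub>E {..n})"
  proof
    fix y assume "y \<in> F ` L"
    then obtain l where l: "l \<in> L" "y = F l" by auto
    have "F l = F (restrict l {..<n})" by (simp add: F_def)
    moreover have "restrict l {..<n} \<in> {..<n} \<rightarrow>\<^sub>E {..n}" using L_le[OF l(1)] by auto
    ultimately show "y \<in> F ` ({..<n} \<rightarrow>\<^sub>E {..n})" using l by auto
  qed
  then have fin: "finite (F ` L)" by (rule finite_subset) (auto intro: finite_PiE)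
  have "(\<lambda>i. if i = 0 then n else 0) \<in> L" using n by (simp add: L_def)
  then have "F ` L \<noteq> {}" by auto
  from Max_in[OF fin this] obtain l where l: "l \<in> L" "F l = Max (F ` L)" by auto
  have opt: "F l' \<le> F l" if "l' \<in> L" for l' using that fin l by simp
  have F0: "0 \<le> F l" unfolding F_def using x orlicz_node_nonneg by (intro sum_nonneg mult_nonneg_nonneg) auto
  define D where "D i = n * (x i * (g (Suc (l i)) - g (l i)))" for i
  \<comment> \<open>Moving one unit from an index \<open>k\<close> to \<open>i\<close> does not increase \<open>F\<close>.\<close>
  have exch: "l k * D i \<le> n * (x k * g (l k))" if i: "i < n" "l i < n" and k: "k < n" for i k
  proof (cases "k = i")
    case True
    have "l i * (g (Suc (l i)) - g (l i)) \<le> g (l i)"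
      using node_Suc_le[OF i(2)] by (simp add: algebra_simps)
    from mult_left_mono[OF this, of "n * x i"] show ?thesis
      using True x[OF i(1)] by (simp add: D_def algebra_simps)
  next
    case False
    show ?thesis
    proof (cases "l k")
      case 0
      then show ?thesis by simp
    next
      case (Suc r)
      define l' where "l' = l(i := Suc (l i), k := r)"
      have split: "(\<Sum>j<n. h j) = h i + h k + (\<Sum>j\<in>{..<n} - {i} - {k}. h j)"
        for h :: "nat \<Rightarrow> 'b::comm_monoid_add"
        using i k False by (simp add: sum.remove[of _ i] sum.remove[of _ k] add.assoc)
      have rest: "(\<Sum>j\<in>{..<n} - {i} - {k}. h (l' j) j) = (\<Sum>j\<in>{..<n} - {i} - {k}. h (l j) j)"
        for h :: "nat \<Rightarrow> nat \<Rightarrow> 'b::comm_monoid_add"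
        by (rule sum.cong) (auto simp: l'_def)
      have "(\<Sum>j<n. l' j) = (\<Sum>j<n. l j)"
        using rest[of "\<lambda>m j. m"] Suc False by (simp add: split l'_def)
      then have "F l' \<le> F l" using opt l by (simp add: L_def)
      then have "x i * g (Suc (l i)) + x k * g r \<le> x i * g (l i) + x k * g (l k)"
        using rest[of "\<lambda>m j. x j * g m"] False unfolding F_def split[of "\<lambda>j. x j * g (l' j)"] split[of "\<lambda>j. x j * g (l j)"]
        by (simp add: l'_def)
      then have D: "x i * (g (Suc (l i)) - g (l i)) \<le> x k * (g (l k) - g r)"
        by (simp add: algebra_simps)
      have "r < n" using L_le[OF l(1) k] Suc by simp
      from node_Suc_le[OF this] have st: "l k * (g (l k) - g r) \<le> g (l k)"
        by (simp add: Suc algebra_simps)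
      have "l k * D i \<le> l k * (n * (x k * (g (l k) - g r)))"
        unfolding D_def using D by (intro mult_left_mono) auto
      also have "\<dots> = n * x k * (l k * (g (l k) - g r))" by simp
      also have "\<dots> \<le> n * x k * g (l k)" using st x[OF k] by (intro mult_left_mono) auto
      finally show ?thesis by simp
    qed
  qed
  \<comment> \<open>Sum \<open>exch\<close> over \<open>k\<close>: the weights \<open>l k\<close>
    add up to \<open>n\<close>, and the right-hand sides to \<open>n * F l\<close>.\<close>
  have DF: "D i \<le> F l" if i: "i < n" "l i < n" for i
  proof -
    have "(\<Sum>k<n. l k * D i) \<le> (\<Sum>k<n. n * (x k * g (l k)))"
      using exch[OF i] by (intro sum_mono) auto
    moreover have "(\<Sum>k<n. l k * D i) = n * D i"
      unfolding sum_distrib_right[symmetric] of_nat_sum[symmetric] using l by (simp add: L_def)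
    ultimately have "n * D i \<le> n * F l" by (simp add: F_def sum_distrib_left)
    then show ?thesis using n by simp
  qed
  \<comment> \<open>A difference of squares factors as \<open>d * (2 * g (l i) + d)\<close>, and
    both occurrences of \<open>d\<close> are replaced through \<open>D i\<close>, which is at most
    \<open>F l\<close>. Summed over \<open>i\<close>, the bound becomes \<open>3 * (F l)^2\<close>.
    If \<open>l i = n\<close> the tail is empty.\<close>
  have tail: "(\<Sum>j\<in>{l i..<n}. (x i * a j)\<^sup>2) / n \<le> F l * (2 * (x i * g (l i)) + F l / n)" if i: "i < n" for i
  proof (cases "l i < n")
    case True
    define d where "d = g (Suc (l i)) - g (l i)"
    have d: "0 \<le> d" using node_mono_Suc[OF True] by (simp add: d_def)
    have D: "D i = n * x i * d" by (simp add: D_def d_def)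
    have D0: "0 \<le> D i" using D d x[OF i] by simp
    have "(\<Sum>j\<in>{l i..<n}. (x i * a j)\<^sup>2) / n = (x i)\<^sup>2 * ((\<Sum>j\<in>{l i..<n}. (a j)\<^sup>2) / n)"
      by (simp add: power_mult_distrib sum_distrib_left)
    also have "\<dots> \<le> (x i)\<^sup>2 * (n * ((g (Suc (l i)))\<^sup>2 - (g (l i))\<^sup>2))"
      using tail_le_node_sq_diff[OF True] by (intro mult_left_mono) auto
    also have "\<dots> = D i * (2 * (x i * g (l i)) + D i / n)"
    proof -
      have "g (Suc (l i)) = g (l i) + d" by (simp add: d_def)
      then show ?thesis using n unfolding D by (simp add: power2_eq_square algebra_simps)
    qed
    also have "\<dots> \<le> F l * (2 * (x i * g (l i)) + F l / n)"
      using DF[OF i True] D0 F0 x[OF i] orlicz_node_nonneg[of n a "l i"]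
      by (intro mult_mono add_mono divide_right_mono order_refl add_nonneg_nonneg) auto
    finally show ?thesis .
  next
    case False
    then show ?thesis using F0 x[OF i] orlicz_node_nonneg[of n a "l i"] by simp
  qed
  have "(\<Sum>i<n. \<Sum>j\<in>{l i..<n}. (x i * a j)\<^sup>2) / n \<le> (\<Sum>i<n. F l * (2 * (x i * g (l i)) + F l / n))"
    unfolding sum_divide_distrib using tail by (intro sum_mono) (auto simp: sum_divide_distrib)
  also have "\<dots> = F l * (2 * F l + F l)"
    unfolding sum_distrib_left[symmetric] sum.distrib F_def[symmetric] using n by simp
  finally have W: "sqrt ((\<Sum>i<n. \<Sum>j\<in>{l i..<n}. (x i * a j)\<^sup>2) / n) \<le> sqrt 3 * F l"
    using F0 by (intro real_le_lsqrt) (auto simp: power_mult_distrib power2_eq_square algebra_simps)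
  have "(\<Sum>i<n. \<Sum>j<l i. x i * a j) / n = (\<Sum>i<n. x i * ((\<Sum>j<l i. a j) / n))"
    by (simp add: sum_distrib_left sum_divide_distrib)
  also have "\<dots> \<le> F l"
    unfolding F_def using x mean_le_orlicz_node by (intro sum_mono mult_left_mono) auto
  finally have S: "(\<Sum>i<n. \<Sum>j<l i. x i * a j) / n \<le> F l" .
  have "(\<Sum>p | p permutes {..<n}. sqrt (\<Sum>i<n. (x i * a (p i))\<^sup>2)) / fact n \<le> F l + sqrt 3 * F l"
    using permutation_average_le[OF n, of "\<lambda>i j. x i * a j" l] x nonneg L_le[OF l(1)] S W by fastforce
  also have "\<dots> = (1 + sqrt 3) * F l" by (simp add: algebra_simps)
  also have "\<dots> \<le> 2 * sqrt 2 * F l"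
  proof (rule mult_right_mono[OF _ F0])
    have "sqrt 3 \<le> 2" by (rule real_le_lsqrt) auto
    then have "(1 + sqrt 3)\<^sup>2 \<le> (2 * sqrt 2)\<^sup>2" by (simp add: power2_sum power_mult_distrib)
    then show "1 + sqrt 3 \<le> 2 * sqrt 2" by (rule power2_le_imp_le) simp
  qed
  finally show thesis using that[of l] l by (simp add: L_def F_def)
qed

end


section \<open>The Orlicz norm as a supremum over the simplex\<close>

context
  fixes M :: "real \<Rightarrow> real"
  assumes bij: "bij_betw (orlicz_dual M) {0..} {0..<\<infinity>}"
begin

lemma orlicz_dual_abs: "orlicz_dual M \<bar>t\<bar> = orlicz_dual M t"
  by (simp add: orlicz_dual_def)

lemma orlicz_dual_0: "orlicz_dual M 0 = 0"
proof -
  have "orlicz_dual M 0 = (\<integral>\<^sup>+ s. 0 \<partial>(lborel :: real measure))"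
    unfolding orlicz_dual_def
  proof (rule nn_integral_cong_AE)
    show "AE s in lborel. deriv_inv M s * indicator {0..\<bar>0\<bar>} s = 0"
      using AE_lborel_singleton[of "0::real"] by eventually_elim (auto simp: indicator_def)
  qed
  then show ?thesis by simp
qed

lemma orlicz_dual_inv_nonneg: "0 \<le> orlicz_dual_inv M s"
  and orlicz_dual_orlicz_dual_inv: "orlicz_dual M (orlicz_dual_inv M s) = ennreal s"
proof -
  have "ennreal s \<in> orlicz_dual M ` {0..}"
    using bij by (simp add: bij_betw_def less_top[symmetric])
  from inv_into_into[OF this] f_inv_into_f[OF this]
  show "0 \<le> orlicz_dual_inv M s" "orlicz_dual M (orlicz_dual_inv M s) = ennreal s"
    by (simp_all add: orlicz_dual_inv_def)
qed

lemma orlicz_dual_finite: "orlicz_dual M t < \<infinity>"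
  using bij_betw_apply[OF bij, of "\<bar>t\<bar>"] by (simp add: orlicz_dual_abs)

lemma orlicz_dual_inv_orlicz_dual: "orlicz_dual_inv M (enn2real (orlicz_dual M t)) = \<bar>t\<bar>"
proof -
  have "ennreal (enn2real (orlicz_dual M t)) = orlicz_dual M \<bar>t\<bar>"
    using orlicz_dual_finite[of t] by (simp add: orlicz_dual_abs)
  then show ?thesis
    unfolding orlicz_dual_inv_def using bij inv_into_f_f[of "orlicz_dual M" "{0..}" "\<bar>t\<bar>"]
    by (simp add: bij_betw_def)
qed

lemma orlicz_dual_inv_0: "orlicz_dual_inv M 0 = 0"
  using orlicz_dual_inv_orlicz_dual[of 0] by (simp add: orlicz_dual_0)

lemma le_orlicz_norm:
  assumes "\<And>i. i < n \<Longrightarrow> 0 \<le> s i" "(\<Sum>i<n. s i) \<le> 1"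
  shows "ereal (\<Sum>i<n. \<bar>x i\<bar> * orlicz_dual_inv M (s i)) \<le> orlicz_norm M (zero_extend n x)"
proof -
  \<comment> \<open>The sign of \<open>y i\<close> follows that of \<open>x i\<close>; the dual
    function is even, so the constraint sees only \<open>s i\<close>.\<close>
  define y where "y i = (if i < n then (if x i < 0 then - 1 else 1) * orlicz_dual_inv M (s i) else 0)" for i
  have "(\<lambda>i. zero_extend n x i * y i) sums (\<Sum>i<n. zero_extend n x i * y i)"
    by (rule sums_finite) (auto simp: y_def)
  moreover have "(\<Sum>i<n. zero_extend n x i * y i) = (\<Sum>i<n. \<bar>x i\<bar> * orlicz_dual_inv M (s i))"
    by (intro sum.cong) (auto simp: zero_extend_def y_def)
  ultimately have xy: "(\<lambda>i. zero_extend n x i * y i) sums (\<Sum>i<n. \<bar>x i\<bar> * orlicz_dual_inv M (s i))"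
    by simp
  have Ny: "orlicz_dual M (y i) = (if i < n then ennreal (s i) else 0)" for i
    using orlicz_dual_abs[of "y i"] orlicz_dual_orlicz_dual_inv[of "s i"] orlicz_dual_inv_nonneg[of "s i"]
    by (auto simp: y_def orlicz_dual_0 abs_mult)
  have "(\<Sum>i. orlicz_dual M (y i)) = (\<Sum>i<n. ennreal (s i))"
    unfolding Ny by (subst suminf_finite[of "{..<n}"]) auto
  also have "\<dots> = ennreal (\<Sum>i<n. s i)" using assms by (intro sum_ennreal) auto
  also have "\<dots> \<le> 1" using assms by simp
  finally show ?thesis
    unfolding orlicz_norm_def using xy
    by (intro SUP_upper2[of y]) (auto simp: sums_iff)
qed

text \<open>An admissible \<open>y\<close> yields the simplex point with coordinates
  \<open>orlicz_dual M (y i)\<close> for \<open>i < n\<close>; the remaining coordinates of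
  \<open>y\<close> pair with zeros. Finiteness of the dual makes the passage to real numbers
  lossless.\<close>

lemma orlicz_norm_le:
  assumes "\<And>s. (\<And>i. i < n \<Longrightarrow> 0 \<le> s i) \<Longrightarrow> (\<Sum>i<n. s i) \<le> 1
      \<Longrightarrow> (\<Sum>i<n. \<bar>x i\<bar> * orlicz_dual_inv M (s i)) \<le> C"
  shows "orlicz_norm M (zero_extend n x) \<le> ereal C"
  unfolding orlicz_norm_def
proof (rule SUP_least, clarify)
  fix y assume y: "(\<Sum>i. orlicz_dual M (y i)) \<le> 1"
  define s where "s i = enn2real (orlicz_dual M (y i))" for i
  have "ennreal (\<Sum>i<n. s i) = (\<Sum>i<n. orlicz_dual M (y i))"
    using orlicz_dual_finite by (simp add: s_def sum_ennreal[symmetric])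
  also have "\<dots> \<le> (\<Sum>i. orlicz_dual M (y i))" by (intro sum_le_suminf) auto
  finally have s: "(\<Sum>i<n. s i) \<le> 1" using y order_trans by fastforce
  have "(\<Sum>i. zero_extend n x i * y i) = (\<Sum>i<n. zero_extend n x i * y i)"
    by (rule suminf_finite) (auto simp: zero_extend_def)
  also have "\<dots> \<le> (\<Sum>i<n. \<bar>x i\<bar> * orlicz_dual_inv M (s i))"
    unfolding s_def orlicz_dual_inv_orlicz_dual
    by (intro sum_mono) (auto simp: zero_extend_def abs_mult[symmetric])
  also have "\<dots> \<le> C" by (rule assms) (use s in \<open>auto simp: s_def\<close>)
  finally show "ereal (\<Sum>i. zero_extend n x i * y i) \<le> ereal C" by simp
qed

end

text \<open>The terms alternate and decrease in modulus, so the partial sums stay between the first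
  even one and the first odd one.\<close>

lemma alternating_factorial_sum_bounds:
  assumes "1 \<le> n"
  shows "0 < (\<Sum>k=1..n. (-1) ^ (k + 1) / fact k :: real)" "(\<Sum>k=1..n. (-1) ^ (k + 1) / fact k :: real) \<le> 1"
proof -
  define c :: "nat \<Rightarrow> real" where "c n = (\<Sum>k=1..n. (-1) ^ (k + 1) / fact k)" for n
  have c_Suc: "c (Suc n) = c n + (-1) ^ n / fact (Suc n)" for n by (simp add: c_def)
  \<comment> \<open>Induction in steps of two. The even sum is only weakly bounded below because
    \<open>c 0 = 0\<close>; strict positivity is claimed from \<open>c 2\<close> on.\<close>
  have odd: "0 \<le> c (2 * m) \<and> c (2 * m) < c (Suc (2 * m)) \<and> c (Suc (2 * m)) \<le> 1
     \<and> 0 < c (Suc (Suc (2 * m)))" for m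
  proof (induction m)
    case 0
    then show ?case by (simp add: c_def numeral_2_eq_2)
  next
    case (Suc m)
    have f: "(0::real) < 1 / fact (Suc k)" "(1::real) / fact (Suc (Suc k)) < 1 / fact (Suc k)" if "0 < k" for k
      using that by (auto intro!: divide_strict_left_mono fact_less_mono simp del: fact_Suc)
    show ?case
      using Suc f[of "Suc (2 * m)"] f[of "Suc (Suc (2 * m))"] f[of "Suc (Suc (Suc (2 * m)))"]
      by (simp add: c_Suc del: fact_Suc)
  qed
  have "0 < c n \<and> c n \<le> 1"
  proof (cases "even n")
    case True
    then obtain m where "n = Suc (Suc (2 * m))" using assms by (metis evenE mult_0_right not_one_le_zero mult_Suc_right add_2_eq_Suc nat.exhaust)
    then show ?thesis using odd[of m] odd[of "Suc m"] by simp
  next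
    case False
    then obtain m where "n = Suc (2 * m)" by (metis oddE Suc_eq_plus1)
    then show ?thesis using odd[of m] by force
  qed
  then show "0 < (\<Sum>k=1..n. (-1) ^ (k + 1) / fact k :: real)" "(\<Sum>k=1..n. (-1) ^ (k + 1) / fact k :: real) \<le> 1"
    by (simp_all add: c_def)
qed

section \<open>Transfer of the node bounds to the Orlicz norm of \<open>M\<close>\<close>

theorem theorem1:
  fixes n :: nat and a :: "nat \<Rightarrow> real" and M :: "real \<Rightarrow> real"
  assumes "1 \<le> n"
    and "\<forall>i j. i \<le> j \<and> j < n \<longrightarrow> a j \<le> a i"
    and "a (n - 1) > 0"
    and "orlicz_function M"
    and "bij_betw (orlicz_dual M) {0..} {0..<\<infinity>}"
    and "\<forall>l\<in>{1..n}. orlicz_dual_inv M (real l / real n) =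
           sqrt (((1 / real n) * (\<Sum>i<l. a i))\<^sup>2
                 + (real l / real n) * ((1 / real n) * (\<Sum>i\<in>{l..<n}. \<bar>a i\<bar>\<^sup>2)))"
    and "\<forall>l<n. \<exists>\<alpha> \<beta>. \<forall>s\<in>{real l / real n..real (Suc l) / real n}.
           orlicz_dual_inv M s = \<alpha> * s + \<beta>"
  shows "\<forall>x :: nat \<Rightarrow> real.
      ereal (1 / (2 * sqrt 5) * ((real n - 1)\<^sup>2 / ((real n)\<^sup>2 + (real n - 1)\<^sup>2)))
          * orlicz_norm M (zero_extend n x)
        \<le> ereal ((\<Sum>\<pi> | \<pi> permutes {..<n}. sqrt (\<Sum>i<n. \<bar>x i * a (\<pi> i)\<bar>\<^sup>2)) / fact n)
      \<and> ereal ((\<Sum>\<pi> | \<pi> permutes {..<n}. sqrt (\<Sum>i<n. \<bar>x i * a (\<pi> i)\<bar>\<^sup>2)) / fact n)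
        \<le> ereal (2 * sqrt 2 / (\<Sum>k=1..n. (-1) ^ (k + 1) / fact k))
          * orlicz_norm M (zero_extend n x)"
proof (intro allI conjI)
  fix x :: "nat \<Rightarrow> real"
  note n = assms(1) and bij = assms(5)
  let ?N = "orlicz_norm M (zero_extend n x)"
  define A where "A = (\<Sum>\<pi> | \<pi> permutes {..<n}. sqrt (\<Sum>i<n. \<bar>x i * a (\<pi> i)\<bar>\<^sup>2)) / fact n"
  have A_eq: "A = (\<Sum>\<pi> | \<pi> permutes {..<n}. sqrt (\<Sum>i<n. (\<bar>x i\<bar> * a (\<pi> i))\<^sup>2)) / fact n"
    by (simp add: A_def power_mult_distrib)
  have A0: "0 \<le> A" unfolding A_def by (intro divide_nonneg_nonneg sum_nonneg) (auto simp: sum_nonneg)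
  interpret decreasing_weights n a
  proof
    show "a j \<le> a i" if "i \<le> j" "j < n" for i j using assms(2) that by blast
    show "0 \<le> a i" if "i < n" for i
    proof -
      have "a (n - 1) \<le> a i" using assms(2) that n by simp
      then show ?thesis using assms(3) by linarith
    qed
  qed
  have node: "orlicz_dual_inv M (l / n) = g l" if "l \<le> n" for l
  proof (cases "l = 0")
    case True
    then show ?thesis using orlicz_dual_inv_0[OF bij] by simp
  next
    case False
    then show ?thesis using assms(6) that by (simp add: orlicz_node_def)
  qed
  \<comment> \<open>An affine piece is determined by its two end values. The node 0, absent from the
    hypothesis, is supplied by \<open>orlicz_dual_inv_0\<close>.\<close>
  have interp: "orlicz_dual_inv M s = g m + (n * s - m) * (g (Suc m) - g m)"
    if m: "m < n" "m \<le> n * s" "n * s \<le> Suc m" for s :: real and m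
  proof -
    obtain \<alpha> \<beta> where
      "\<forall>s\<in>{real m / real n..real (Suc m) / real n}. orlicz_dual_inv M s = \<alpha> * s + \<beta>"
      using assms(7) m(1) by blast
    then have aff: "orlicz_dual_inv M s = \<alpha> * s + \<beta>"
      if "m / n \<le> s" "s \<le> Suc m / n" for s using that by simp
    have gm: "g m = \<alpha> * (m / n) + \<beta>"
      using aff[of "m / n"] node[of m] m(1) by (simp add: divide_right_mono)
    have "g (Suc m) = \<alpha> * (Suc m / n) + \<beta>"
      using aff[of "Suc m / n"] node[of "Suc m"] m(1) by (simp add: divide_right_mono)
    then have "g (Suc m) - g m = \<alpha> / n"
      unfolding gm using n by (simp add: field_simps)
    moreover have "orlicz_dual_inv M s = \<alpha> * s + \<beta>"
      using aff[of s] m n by (simp add: divide_simps mult.commute)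
    ultimately show ?thesis unfolding gm using n by (simp add: field_simps)
  qed
  have norm_le: "?N \<le> ereal (4 * sqrt 5 * A)" if n2: "2 \<le> n"
  proof (rule orlicz_norm_le[OF bij])
    fix s :: "nat \<Rightarrow> real"
    assume s: "\<And>i. i < n \<Longrightarrow> 0 \<le> s i" "(\<Sum>i<n. s i) \<le> 1"
    \<comment> \<open>At \<open>s i = 1\<close> the floor would be \<open>n\<close>, outside the
      range of intervals, so the last interval is taken.\<close>
    define m where "m i = (if s i = 1 then n - 1 else nat \<lfloor>n * s i\<rfloor>)" for i
    have m: "m i < n \<and> m i \<le> n * s i \<and> n * s i \<le> Suc (m i)" if i: "i < n" for i
    proof (cases "s i = 1")
      case True
      then show ?thesis using n by (simp add: m_def)
    next
      case False
      have "s i \<le> (\<Sum>i<n. s i)" using s i by (intro member_le_sum) auto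
      with s(2) False have "s i < 1" by linarith
      then have "n * s i < n" "0 \<le> n * s i" using n s(1)[OF i] by auto
      then show ?thesis using False by (simp add: m_def) linarith
    qed
    show "(\<Sum>i<n. \<bar>x i\<bar> * orlicz_dual_inv M (s i)) \<le> 4 * sqrt 5 * A"
      unfolding A_eq using m s interp by (intro average_ge[OF n2, where m = m and s = s]) auto
  qed
  show "ereal (1 / (2 * sqrt 5) * ((real n - 1)\<^sup>2 / ((real n)\<^sup>2 + (real n - 1)\<^sup>2))) * ?N
      \<le> ereal ((\<Sum>\<pi> | \<pi> permutes {..<n}. sqrt (\<Sum>i<n. \<bar>x i * a (\<pi> i)\<bar>\<^sup>2)) / fact n)"
    unfolding A_def[symmetric]
  \<comment> \<open>For \<open>n = 1\<close> the constant is 0, and in \<open>ereal\<close> its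
    product with the norm is 0.\<close>
  proof (cases "n = 1")
    case True
    then show "ereal (1 / (2 * sqrt 5) * ((real n - 1)\<^sup>2 / ((real n)\<^sup>2 + (real n - 1)\<^sup>2))) * ?N \<le> ereal A"
      using A0 by (simp add: zero_ereal_def[symmetric])
  next
    case False
    define q where "q = (real n - 1)\<^sup>2 / ((real n)\<^sup>2 + (real n - 1)\<^sup>2)"
    have "2 * (real n - 1)\<^sup>2 \<le> (real n)\<^sup>2 + (real n - 1)\<^sup>2"
      using n by (simp add: power2_eq_square algebra_simps)
    \<comment> \<open>\<open>q\<close> is at most 1/2, so multiplying \<open>4 * sqrt 5\<close> by
      \<open>q / (2 * sqrt 5)\<close> gives \<open>2 * q\<close>, which is at most 1.\<close>
    moreover have "0 < (real n)\<^sup>2 + (real n - 1)\<^sup>2" using n by (intro add_pos_nonneg) auto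
    ultimately have q: "0 \<le> q" "q \<le> 1 / 2" by (auto simp: q_def field_simps)
    have "ereal (1 / (2 * sqrt 5) * q) * ?N \<le> ereal (1 / (2 * sqrt 5) * q) * ereal (4 * sqrt 5 * A)"
      using q n False by (intro ereal_mult_left_mono norm_le) auto
    also have "\<dots> = ereal (2 * q * A)" by simp
    also have "\<dots> \<le> ereal A" using q A0 mult_right_mono[of "2 * q" 1 A] by simp
    finally show "ereal (1 / (2 * sqrt 5) * ((real n - 1)\<^sup>2 / ((real n)\<^sup>2 + (real n - 1)\<^sup>2))) * ?N \<le> ereal A"
      unfolding q_def .
  qed
  define c where "c = (\<Sum>k=1..n. (-1) ^ (k + 1) / fact k :: real)"
  have c: "0 < c" "c \<le> 1" using alternating_factorial_sum_bounds[OF n] by (auto simp: c_def)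
  obtain l where l: "(\<Sum>i<n. l i) = n" "A \<le> 2 * sqrt 2 * (\<Sum>i<n. \<bar>x i\<bar> * g (l i))"
    unfolding A_eq by (rule average_le[OF n, of "\<lambda>i. \<bar>x i\<bar>"]) auto
  define F where "F = (\<Sum>i<n. \<bar>x i\<bar> * g (l i))"
  have F0: "0 \<le> F" unfolding F_def by (intro sum_nonneg mult_nonneg_nonneg orlicz_node_nonneg) auto
  have l_le: "l i \<le> n" if "i < n" for i
    using that member_le_sum[of i "{..<n}" l] l(1) by auto
  \<comment> \<open>The maximising integers, divided by \<open>n\<close>, form a point of the
    simplex, so \<open>F\<close> is one of the values bounded by the norm.\<close>
  have "(\<Sum>i<n. real (l i) / n) = 1"
    unfolding sum_divide_distrib[symmetric] of_nat_sum[symmetric] l(1) using n by simp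
  then have "ereal (\<Sum>i<n. \<bar>x i\<bar> * orlicz_dual_inv M (l i / n)) \<le> ?N"
    by (intro le_orlicz_norm[OF bij]) auto
  then have FN: "ereal F \<le> ?N" using l_le by (simp add: F_def node)
  have "A \<le> 2 * sqrt 2 * F" using l by (simp add: F_def)
  also have "\<dots> \<le> 2 * sqrt 2 / c * F"
    using c F0 by (intro mult_right_mono) (auto simp: le_divide_eq)
  finally have "ereal A \<le> ereal (2 * sqrt 2 / c) * ereal F" by simp
  also have "\<dots> \<le> ereal (2 * sqrt 2 / c) * ?N"
    using c FN by (intro ereal_mult_left_mono) auto
  finally show "ereal ((\<Sum>\<pi> | \<pi> permutes {..<n}. sqrt (\<Sum>i<n. \<bar>x i * a (\<pi> i)\<bar>\<^sup>2)) / fact n)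
      \<le> ereal (2 * sqrt 2 / (\<Sum>k=1..n. (-1) ^ (k + 1) / fact k)) * ?N"
    unfolding A_def c_def .
qed

end
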